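(* Let $(\mathfrak h,[\cdot,\cdot]_{\mathfrak h})$ be a Leibniz algebra. Then $\Pi(\mathfrak h)$ is a sub-Leibniz algebra of $(\mathfrak{Der}(\mathfrak h),[\cdot,\cdot]_s)$.
   Context: All vector spaces are over a fixed ground field. A (left) Leibniz algebra is a vector space with a bilinear bracket satisfying $[x,[y,z]]=[[x,y],z]+[y,[x,z]]$. $\mathrm{Der}^L(\mathfrak h)=\{D\in\mathfrak{gl}(\mathfrak h): D[\alpha,\beta]_{\mathfrak h}=[D\alpha,\beta]_{\mathfrak h}+[\alpha,D\beta]_{\mathfrak h}\}$, $\mathrm{Der}^R(\mathfrak h)=\{D\in\mathfrak{gl}(\mathfrak h): D[\alpha,\beta]_{\mathfrak h}=[\alpha,D\beta]_{\mathfrak h}-[\beta,D\alpha]_{\mathfrak h}\}$. $\mathfrak{Der}(\mathfrak h)=\mathrm{Der}^L(\mathfrak h)\oplus\mathrm{Der}^R(\mathfrak h)$ is a Leibniz algebra with bracket $[(D^L_1,D^R_1),(D^L_2,D^R_2)]_s=([D^L_1,D^L_2],[D^L_1,D^R_2])$, where $[D_1,D_2]=D_1D_2-D_2D_1$. $\Delta(\mathfrak h)=\mathrm{span}\{[\alpha,\alpha]_{\mathfrak h}:\alpha\in\mathfrak h\}$, and $\Pi(\mathfrak h)=\{(D^L,D^R)\in\mathfrak{Der}(\mathfrak h): D^L\alpha+D^R\alpha\in\Delta(\mathfrak h)\ \forall\alpha\in\mathfrak h\}$. *)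

theory Defs
  imports Complex_Main "HOL-Library.Function_Algebras" "HOL-Library.Product_Plus"
begin

text \<open>A left Leibniz algebra whose underlying space is the subspace \<open>S\<close> of an ambient vector
  space. A Leibniz algebra filling a whole type is the case \<open>S = UNIV\<close>; outside \<open>S\<close> the bracket
  is unconstrained.\<close>

locale leibniz_algebra = vector_space scale
  for scale :: "'k::field \<Rightarrow> 'v::ab_group_add \<Rightarrow> 'v" (infixr "*s" 75) +
  fixes br :: "'v \<Rightarrow> 'v \<Rightarrow> 'v" and S :: "'v set"
  assumes subspace_carrier: "subspace S"
    and br_closed: "\<lbrakk>x \<in> S; y \<in> S\<rbrakk> \<Longrightarrow> br x y \<in> S"
    and br_add_left: "\<lbrakk>x \<in> S; y \<in> S; z \<in> S\<rbrakk> \<Longrightarrow> br (x + y) z = br x z + br y z"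
    and br_add_right: "\<lbrakk>x \<in> S; y \<in> S; z \<in> S\<rbrakk> \<Longrightarrow> br x (y + z) = br x y + br x z"
    and br_scale_left: "\<lbrakk>x \<in> S; y \<in> S\<rbrakk> \<Longrightarrow> br (c *s x) y = c *s br x y"
    and br_scale_right: "\<lbrakk>x \<in> S; y \<in> S\<rbrakk> \<Longrightarrow> br x (c *s y) = c *s br x y"
    and leibniz: "\<lbrakk>x \<in> S; y \<in> S; z \<in> S\<rbrakk> \<Longrightarrow> br x (br y z) = br (br x y) z + br y (br x z)"

locale leibniz_subalgebra = leibniz_algebra scale br S
  for scale :: "'k::field \<Rightarrow> 'v::ab_group_add \<Rightarrow> 'v" (infixr "*s" 75)
    and br :: "'v \<Rightarrow> 'v \<Rightarrow> 'v" and S :: "'v set" +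
  fixes T :: "'v set"
  assumes sub_subset: "T \<subseteq> S"
    and sub_subspace: "subspace T"
    and sub_br_closed: "\<lbrakk>x \<in> T; y \<in> T\<rbrakk> \<Longrightarrow> br x y \<in> T"

definition gl :: "('k::field \<Rightarrow> 'v::ab_group_add \<Rightarrow> 'v) \<Rightarrow> ('v \<Rightarrow> 'v) set" where
  "gl scale = {D. Vector_Spaces.linear scale scale D}"

definition commutator :: "('v \<Rightarrow> 'v) \<Rightarrow> ('v \<Rightarrow> 'v) \<Rightarrow> 'v \<Rightarrow> 'v::ab_group_add" where
  "commutator D1 D2 = (D1 \<circ> D2) - (D2 \<circ> D1)"

definition DerL ::
  "('k::field \<Rightarrow> 'v::ab_group_add \<Rightarrow> 'v) \<Rightarrow> ('v \<Rightarrow> 'v \<Rightarrow> 'v) \<Rightarrow> ('v \<Rightarrow> 'v) set" where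
  "DerL scale br = {D \<in> gl scale. \<forall>\<alpha> \<beta>. D (br \<alpha> \<beta>) = br (D \<alpha>) \<beta> + br \<alpha> (D \<beta>)}"

definition DerR ::
  "('k::field \<Rightarrow> 'v::ab_group_add \<Rightarrow> 'v) \<Rightarrow> ('v \<Rightarrow> 'v \<Rightarrow> 'v) \<Rightarrow> ('v \<Rightarrow> 'v) set" where
  "DerR scale br = {D \<in> gl scale. \<forall>\<alpha> \<beta>. D (br \<alpha> \<beta>) = br \<alpha> (D \<beta>) - br \<beta> (D \<alpha>)}"

text \<open>The direct sum of the two spaces of derivations is external: it lives in the pairs of maps,
  with componentwise addition (from the library instances for products and functions) and the
  componentwise, pointwise scalar multiplication \<open>scale_maps\<close>.\<close>

definition Der ::
  "('k::field \<Rightarrow> 'v::ab_group_add \<Rightarrow> 'v) \<Rightarrow> ('v \<Rightarrow> 'v \<Rightarrow> 'v) \<Rightarrow> (('v \<Rightarrow> 'v) \<times> ('v \<Rightarrow> 'v)) set" where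
  "Der scale br = DerL scale br \<times> DerR scale br"

definition scale_maps ::
  "('k \<Rightarrow> 'v \<Rightarrow> 'v) \<Rightarrow> 'k \<Rightarrow> ('v \<Rightarrow> 'v) \<times> ('v \<Rightarrow> 'v) \<Rightarrow> ('v \<Rightarrow> 'v) \<times> ('v \<Rightarrow> 'v)" where
  "scale_maps scale c = (\<lambda>(D, E). (\<lambda>x. scale c (D x), \<lambda>x. scale c (E x)))"

definition br_s ::
  "('v \<Rightarrow> 'v) \<times> ('v \<Rightarrow> 'v) \<Rightarrow> ('v \<Rightarrow> 'v) \<times> ('v \<Rightarrow> 'v) \<Rightarrow> ('v \<Rightarrow> 'v) \<times> ('v \<Rightarrow> 'v::ab_group_add)" where
  "br_s = (\<lambda>(DL1, DR1) (DL2, DR2). (commutator DL1 DL2, commutator DL1 DR2))"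

definition Delta ::
  "('k::field \<Rightarrow> 'v::ab_group_add \<Rightarrow> 'v) \<Rightarrow> ('v \<Rightarrow> 'v \<Rightarrow> 'v) \<Rightarrow> 'v set" where
  "Delta scale br = module.span scale {br \<alpha> \<alpha> | \<alpha>. True}"

definition Pi_Der ::
  "('k::field \<Rightarrow> 'v::ab_group_add \<Rightarrow> 'v) \<Rightarrow> ('v \<Rightarrow> 'v \<Rightarrow> 'v) \<Rightarrow> (('v \<Rightarrow> 'v) \<times> ('v \<Rightarrow> 'v)) set" where
  "Pi_Der scale br = {(DL, DR) \<in> Der scale br. \<forall>\<alpha>. DL \<alpha> + DR \<alpha> \<in> Delta scale br}"

end

theory Submission
  imports Defs
begin

text \<open>
  Write \<open>(D, E)\<close> for a pair of a left and a right derivation. The commutator of \<open>D\<close> with a left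
  derivation is again a left derivation, and its commutator with a right derivation is again a right
  derivation; the Leibniz identity for \<open>br_s\<close> is then the Jacobi identity for commutators of
  additive maps, read in each component. This makes the derivation pairs a Leibniz algebra.

  For the subalgebra, the point is that the bracket of \<open>(D1, E1)\<close> with \<open>(D2, E2)\<close> has component
  sum \<open>[D1, D2] + [D1, E2] = D1 \<circ> (D2 + E2) - (D2 + E2) \<circ> D1\<close>. When \<open>D2 + E2\<close> takes values in the
  span of squares, so does the second term, and the first one does because a left derivation maps
  the span of squares into itself (\<open>DerL_preserves_Delta\<close>): the derivative of a square,
  \<open>br (D \<alpha>) \<alpha> + br \<alpha> (D \<alpha>)\<close>, is the polarization of the square.
\<close>

lemma vector_space_scale_maps:
  assumes "vector_space scale"
  shows "vector_space (scale_maps scale)"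
proof -
  interpret vector_space scale by fact
  show ?thesis
    by unfold_locales
      (auto simp: scale_maps_def fun_eq_iff scale_right_distrib scale_left_distrib)
qed

lemma commutator_apply: "commutator D E x = D (E x) - E (D x)"
  by (simp add: commutator_def)

lemma commutator_jacobi:
  assumes "additive A" "additive B" "additive C"
  shows "commutator A (commutator B C)
       = commutator (commutator A B) C + commutator B (commutator A C)"
proof -
  interpret A: additive A by fact
  interpret B: additive B by fact
  interpret C: additive C by fact
  show ?thesis
    by (simp add: fun_eq_iff commutator_apply A.diff B.diff C.diff)
qed

lemma commutator_add_left:
  assumes "additive C"
  shows "commutator (A + B) C = commutator A C + commutator B C"
  using additive.add[OF assms] by (simp add: fun_eq_iff commutator_apply)

lemma commutator_add_right:
  assumes "additive A"
  shows "commutator A (B + C) = commutator A B + commutator A C"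
  using additive.add[OF assms] by (simp add: fun_eq_iff commutator_apply)

context vector_space
begin

lemma mem_gl_iff: "D \<in> gl scale \<longleftrightarrow> additive D \<and> (\<forall>c x. D (scale c x) = scale c (D x))"
  using vector_space_axioms
  by (auto simp: gl_def Vector_Spaces.linear_iff additive_def)

lemma gl_simps:
  assumes "D \<in> gl scale"
  shows "D 0 = 0" "D (x + y) = D x + D y" "D (x - y) = D x - D y" "D (scale c x) = scale c (D x)"
  using assms additive.zero additive.add additive.diff by (auto simp: mem_gl_iff)

lemma glI:
  "(\<And>x y. D (x + y) = D x + D y) \<Longrightarrow> (\<And>c x. D (scale c x) = scale c (D x)) \<Longrightarrow> D \<in> gl scale"
  by (simp add: mem_gl_iff additive_def)

lemma commutator_in_gl:
  assumes "D \<in> gl scale" "E \<in> gl scale"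
  shows "commutator D E \<in> gl scale"
  by (rule glI)
    (simp_all add: commutator_apply gl_simps[OF assms(1)] gl_simps[OF assms(2)]
      scale_right_diff_distrib)

lemma commutator_scale_left:
  assumes "E \<in> gl scale"
  shows "commutator (\<lambda>x. scale c (D x)) E = (\<lambda>x. scale c (commutator D E x))"
  by (simp add: fun_eq_iff commutator_apply gl_simps[OF assms] scale_right_diff_distrib)

lemma commutator_scale_right:
  assumes "D \<in> gl scale"
  shows "commutator D (\<lambda>x. scale c (E x)) = (\<lambda>x. scale c (commutator D E x))"
  by (simp add: fun_eq_iff commutator_apply gl_simps[OF assms] scale_right_diff_distrib)

end

context
  fixes scale :: "'k::field \<Rightarrow> 'h::ab_group_add \<Rightarrow> 'h" and br :: "'h \<Rightarrow> 'h \<Rightarrow> 'h"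
  assumes leibniz_UNIV: "leibniz_algebra scale br UNIV"
begin

interpretation leibniz_algebra scale br UNIV
  by (rule leibniz_UNIV)

lemma br_add:
  "br (x + y) z = br x z + br y z" "br x (y + z) = br x y + br x z"
  by (simp_all add: br_add_left br_add_right)

lemma br_scale:
  "br (scale c x) y = scale c (br x y)" "br x (scale c y) = scale c (br x y)"
  by (simp_all add: br_scale_left br_scale_right)

lemma br_zero: "br 0 y = 0" "br x 0 = 0"
  using br_add(1)[of 0 0 y] br_add(2)[of x 0 0] by simp_all

lemma br_diff:
  "br (x - y) z = br x z - br y z" "br x (y - z) = br x y - br x z"
  using br_add(1)[of "x - y" y z] br_add(2)[of x "y - z" z] by (simp_all add: algebra_simps)

lemma DerL_commutator:
  assumes "D \<in> DerL scale br" "E \<in> DerL scale br"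
  shows "commutator D E \<in> DerL scale br"
proof -
  have gl: "D \<in> gl scale" "E \<in> gl scale"
    and der: "\<And>x y. D (br x y) = br (D x) y + br x (D y)"
      "\<And>x y. E (br x y) = br (E x) y + br x (E y)"
    using assms by (auto simp: DerL_def)
  show ?thesis
    by (simp add: DerL_def commutator_in_gl gl commutator_apply der br_diff
        gl_simps[OF gl(1)] gl_simps[OF gl(2)])
qed

text \<open>In both \<open>D (E (br x y))\<close> and \<open>E (D (br x y))\<close> the terms with one map on each factor sum to
  \<open>br (D x) (E y) - br (D y) (E x)\<close>, so they cancel in the commutator.\<close>

lemma DerR_commutator:
  assumes "D \<in> DerL scale br" "E \<in> DerR scale br"
  shows "commutator D E \<in> DerR scale br"
proof -
  have gl: "D \<in> gl scale" "E \<in> gl scale"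
    and der: "\<And>x y. D (br x y) = br (D x) y + br x (D y)"
      "\<And>x y. E (br x y) = br x (E y) - br y (E x)"
    using assms by (auto simp: DerL_def DerR_def)
  show ?thesis
    by (simp add: DerR_def commutator_in_gl gl commutator_apply der br_diff
        gl_simps[OF gl(1)] gl_simps[OF gl(2)])
qed

lemma DerL_add: "D \<in> DerL scale br \<Longrightarrow> E \<in> DerL scale br \<Longrightarrow> D + E \<in> DerL scale br"
  by (auto simp: DerL_def gl_simps br_add scale_right_distrib algebra_simps intro!: glI)

lemma DerR_add: "D \<in> DerR scale br \<Longrightarrow> E \<in> DerR scale br \<Longrightarrow> D + E \<in> DerR scale br"
  by (auto simp: DerR_def gl_simps br_add scale_right_distrib algebra_simps intro!: glI)

lemma DerL_scale: "D \<in> DerL scale br \<Longrightarrow> (\<lambda>x. scale c (D x)) \<in> DerL scale br"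
  by (auto simp: DerL_def gl_simps br_scale scale_right_distrib scale_left_commute intro!: glI)

lemma DerR_scale: "D \<in> DerR scale br \<Longrightarrow> (\<lambda>x. scale c (D x)) \<in> DerR scale br"
  by (auto simp: DerR_def gl_simps br_scale scale_right_distrib scale_right_diff_distrib
      scale_left_commute intro!: glI)

lemma zero_in_DerL_DerR: "0 \<in> DerL scale br" "0 \<in> DerR scale br"
  by (auto simp: DerL_def DerR_def br_zero intro!: glI)

lemmas subspace_DerL_DerR = DerL_add DerR_add DerL_scale DerR_scale zero_in_DerL_DerR

lemma DerL_preserves_Delta:
  assumes D: "D \<in> DerL scale br" and x: "x \<in> Delta scale br"
  shows "D x \<in> Delta scale br"
proof -
  have gl: "D \<in> gl scale" and der: "\<And>x y. D (br x y) = br (D x) y + br x (D y)"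
    using D by (auto simp: DerL_def)
  have square: "br a a \<in> Delta scale br" for a
    unfolding Delta_def by (rule span_base) auto
  have "D (br a a) = br (D a + a) (D a + a) - br (D a) (D a) - br a a" for a
    by (simp add: der br_add)
  then have D_square: "D (br a a) \<in> Delta scale br" for a
    using square unfolding Delta_def by (simp add: span_diff)
  show ?thesis
    using x unfolding Delta_def
  proof (induction rule: span_induct_alt)
    case base
    then show ?case by (simp add: gl_simps[OF gl] span_zero)
  next
    case (step c s y)
    then show ?case
      using D_square unfolding Delta_def
      by (auto simp: gl_simps[OF gl] intro: span_add span_scale)
  qed
qed

lemma leibniz_algebra_Der: "leibniz_algebra (scale_maps scale) br_s (Der scale br)"
proof -
  interpret maps: vector_space "scale_maps scale"
    by (rule vector_space_scale_maps) (rule vector_space_axioms)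
  have gl: "D \<in> gl scale" "additive D" if "D \<in> DerL scale br \<or> D \<in> DerR scale br" for D
    using that by (auto simp: DerL_def DerR_def mem_gl_iff)
  show ?thesis
  proof
    show "maps.subspace (Der scale br)"
      by (auto simp: maps.subspace_def Der_def scale_maps_def zero_prod_def subspace_DerL_DerR)
  qed (auto simp: Der_def br_s_def scale_maps_def gl DerL_commutator DerR_commutator
      commutator_add_left commutator_add_right commutator_scale_left commutator_scale_right
      intro!: commutator_jacobi)
qed

lemma br_s_Pi_Der:
  assumes p: "p \<in> Pi_Der scale br" and q: "q \<in> Pi_Der scale br"
  shows "br_s p q \<in> Pi_Der scale br"
proof -
  obtain D1 E1 D2 E2 where pq: "p = (D1, E1)" "q = (D2, E2)"
    by fastforce
  have D1: "D1 \<in> DerL scale br" and q': "D2 \<in> DerL scale br" "E2 \<in> DerR scale br"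
    and sum: "\<And>a. D2 a + E2 a \<in> Delta scale br"
    using p q by (auto simp: pq Pi_Der_def Der_def)
  have "commutator D1 D2 a + commutator D1 E2 a \<in> Delta scale br" for a
  proof -
    have "D1 \<in> gl scale"
      using D1 by (simp add: DerL_def)
    then have "commutator D1 D2 a + commutator D1 E2 a
        = D1 (D2 a + E2 a) - (D2 (D1 a) + E2 (D1 a))"
      by (simp add: commutator_apply gl_simps)
    moreover have "\<dots> \<in> Delta scale br"
      using DerL_preserves_Delta[OF D1 sum] sum unfolding Delta_def by (rule span_diff)
    ultimately show ?thesis by simp
  qed
  then show ?thesis
    using D1 q' by (simp add: pq Pi_Der_def Der_def br_s_def DerL_commutator DerR_commutator)
qed

lemma subspace_Pi_Der: "module.subspace (scale_maps scale) (Pi_Der scale br)"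
proof -
  interpret maps: vector_space "scale_maps scale"
    by (rule vector_space_scale_maps) (rule vector_space_axioms)
  \<comment> \<open>The component sums are linear in the pair, and their values are regrouped accordingly.\<close>
  have add: "(a + b) + (c + d) \<in> Delta scale br"
    if "a + c \<in> Delta scale br" "b + d \<in> Delta scale br" for a b c d
    using span_add[OF that[unfolded Delta_def]] by (simp add: Delta_def algebra_simps)
  have scale: "scale c a + scale c b \<in> Delta scale br" if "a + b \<in> Delta scale br" for a b c
    using span_scale[OF that[unfolded Delta_def], of c] by (simp add: Delta_def scale_right_distrib)
  have zero: "0 \<in> Delta scale br"
    by (simp add: Delta_def span_zero)
  show ?thesis
    by (auto simp: maps.subspace_def Pi_Der_def Der_def scale_maps_def zero_prod_def
        subspace_DerL_DerR zero intro: add scale)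
qed

end

theorem proposition3p5:
  fixes scale :: "'k::field \<Rightarrow> 'h::ab_group_add \<Rightarrow> 'h"
    and br :: "'h \<Rightarrow> 'h \<Rightarrow> 'h"
  assumes "leibniz_algebra scale br UNIV"
  shows "leibniz_subalgebra (scale_maps scale) br_s (Der scale br) (Pi_Der scale br)"
proof -
  interpret leibniz_algebra "scale_maps scale" br_s "Der scale br"
    by (rule leibniz_algebra_Der) fact
  show ?thesis
  proof
    show "Pi_Der scale br \<subseteq> Der scale br"
      by (auto simp: Pi_Der_def)
  qed (simp_all add: subspace_Pi_Der[OF assms] br_s_Pi_Der[OF assms])
qed

end
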